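(* Let $d_{\Delta^\infty}:Bar_0\to\mathbb{R}$, $D\mapsto d_\infty(D,\Delta^\infty)$, be the bottleneck distance to the empty barcode $\Delta^\infty$, and let \[ Bar_\Delta:=\Big\{D\in Bar_0\ \Big|\ \#\operatorname*{argmax}_{(b,d)\in D}\tfrac{|d-b|}{2}=1\Big\}. \] For any $D\in Bar_\Delta$: (i) $d_{\Delta^\infty}$ is $\infty$-differentiable at $D$; and (ii) for any $m\in\mathbb{N}$ and $\tilde D\in\mathbb{R}^{2m}\times\mathbb{R}^0$ such that $Q_{m,0}(\tilde D)=D$, there are exactly two non-zero components in the gradient $\nabla_{\tilde D}(d_{\Delta^\infty}\circ Q_{m,0})$, one with value $\frac12$ and the other with value $-\frac12$.
   Context: Barcodes: a barcode is a multiset $D=D'\cup\Delta^\infty$, where $D'$ is a finite multiset of elements of $\mathbb{R}\times(\mathbb{R}\cup\{+\infty\})$ and $\Delta^\infty$ consists of the diagonal $\Delta=\{(b,b)\mid b\in\mathbb{R}\}$ with countably infinite multiplicity. $Bar_0$ is the set of barcodes with no infinite interval (no point with second coordinate $+\infty$). For $m\in\mathbb{N}$, $Q_{m,0}:\mathbb{R}^{2m}\to Bar_0$ is $Q_{m,0}(b_1,d_1,\dots,b_m,d_m)=\{(b_i,d_i)\}_{i=1}^m\cup\Delta^\infty$. The bottleneck distance is $d_\infty(D,D')=\inf_\gamma\sup_{x\in D}\|x-\gamma(x)\|_\infty$, where $\gamma$ ranges over bijections of multisets $D\to D'$. In the definition of $Bar_\Delta$ the argmax is counted with multiplicity in the multiset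 $D$: $D\in Bar_\Delta$ means that $D$ has a unique point (of multiplicity one) at maximal distance from the diagonal. A map $V:Bar_0\to\mathbb{R}$ is $\infty$-differentiable at $D\in Bar_0$ if for all $m\in\mathbb{N}$ and all $\tilde D\in\mathbb{R}^{2m}$ with $Q_{m,0}(\tilde D)=D$, the map $V\circ Q_{m,0}$ is $C^\infty$ on an open neighborhood of $\tilde D$. *)

theory Defs
  imports
    "HOL-Analysis.Analysis"
    "HOL-Library.Multiset"
    "HOL-Library.Extended_Nat"
    "HOL-Library.Extended_Real"
begin

section \<open>Barcodes\<close>

text \<open>
  A barcode is a multiset on the extended plane in which the diagonal points have infinite
  multiplicity, so it is represented by its multiplicity function with values in \<^typ>\<open>enat\<close>.
\<close>

type_synonym barcode = "real \<times> ereal \<Rightarrow> enat"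

definition diagonal :: "(real \<times> ereal) set" where
  "diagonal = {(b, ereal b) | b. True}"

definition empty_barcode :: barcode where
  "empty_barcode x = (if x \<in> diagonal then \<infinity> else 0)"

definition barcode_of :: "(real \<times> ereal) multiset \<Rightarrow> barcode" where
  "barcode_of M x = enat (count M x) + empty_barcode x"

text \<open>
  Second coordinates range over the reals and plus infinity. They are not required to
  exceed the first coordinate.
\<close>

definition Bar :: "barcode set" where
  "Bar = {barcode_of M | M. \<forall>x \<in># M. snd x \<noteq> -\<infinity>}"

definition Bar0 :: "barcode set" where
  "Bar0 = {D \<in> Bar. \<forall>b. D (b, \<infinity>) = 0}"

text \<open>
  The elements of a barcode counted with multiplicity: a point of multiplicity \<open>k\<close> contributes
  \<open>k\<close> labelled copies. A bijection of multisets is a bijection between sets of labelled copies.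
\<close>

definition copies :: "barcode \<Rightarrow> ((real \<times> ereal) \<times> nat) set" where
  "copies D = {(x, k). enat k < D x}"


section \<open>The bottleneck distance\<close>

text \<open>
  The case distinction makes the distance between two infinite coordinates 0; plain
  \<^typ>\<open>ereal\<close> subtraction would give infinity.
\<close>

definition coord_dist :: "ereal \<Rightarrow> ereal \<Rightarrow> ereal" where
  "coord_dist s t = (if s = t then 0 else \<bar>s - t\<bar>)"

definition linf_dist :: "real \<times> ereal \<Rightarrow> real \<times> ereal \<Rightarrow> ereal" where
  "linf_dist x y = max (ereal \<bar>fst x - fst y\<bar>) (coord_dist (snd x) (snd y))"

definition bottleneck :: "barcode \<Rightarrow> barcode \<Rightarrow> ereal" where
  "bottleneck D E =
     (INF \<gamma> \<in> {\<gamma>. bij_betw \<gamma> (copies D) (copies E)}.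
        SUP p \<in> copies D. linf_dist (fst p) (fst (\<gamma> p)))"

text \<open>
  On \<open>Bar0\<close> the bottleneck distance to the empty barcode is finite (match every off-diagonal
  point with a diagonal point), so passing to \<^typ>\<open>real\<close> loses nothing there.
\<close>

definition dist_empty :: "barcode \<Rightarrow> real" where
  "dist_empty D = real_of_ereal (bottleneck D empty_barcode)"

definition diag_dist :: "real \<times> ereal \<Rightarrow> ereal" where
  "diag_dist x = \<bar>snd x - ereal (fst x)\<bar> / 2"

definition Bar_Delta :: "barcode set" where
  "Bar_Delta =
     {D \<in> Bar0. card {p. is_arg_max (\<lambda>p. diag_dist (fst p)) (\<lambda>p. p \<in> copies D) p} = 1}"


section \<open>Smooth functions on n-dimensional Euclidean space\<close>

text \<open>
  Since the dimension is quantified inside the notion of differentiability below, n-dimensional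
  space is the carrier \<open>topspace (Euclidean_space n)\<close>, i.e. the sequences vanishing from
  index \<open>n\<close> on. Coordinates are numbered from 0.
\<close>

definition partial :: "nat \<Rightarrow> ((nat \<Rightarrow> real) \<Rightarrow> real) \<Rightarrow> (nat \<Rightarrow> real) \<Rightarrow> real" where
  "partial i f x = deriv (\<lambda>t. f (x(i := t))) (x i)"

text \<open>\<open>Ck_on n U k f\<close>: all iterated partial derivatives of \<open>f\<close> of order at most \<open>k\<close> exist
  and are continuous on the open set \<open>U\<close> of n-dimensional space.\<close>

primrec Ck_on ::
  "nat \<Rightarrow> (nat \<Rightarrow> real) set \<Rightarrow> nat \<Rightarrow> ((nat \<Rightarrow> real) \<Rightarrow> real) \<Rightarrow> bool" where
  "Ck_on n U 0 f \<longleftrightarrow> continuous_map (subtopology (Euclidean_space n) U) euclideanreal f"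
| "Ck_on n U (Suc k) f \<longleftrightarrow>
     continuous_map (subtopology (Euclidean_space n) U) euclideanreal f \<and>
     (\<forall>i<n. (\<forall>x\<in>U. (\<lambda>t. f (x(i := t))) field_differentiable (at (x i))) \<and>
            Ck_on n U k (partial i f))"

definition smooth_on :: "nat \<Rightarrow> (nat \<Rightarrow> real) set \<Rightarrow> ((nat \<Rightarrow> real) \<Rightarrow> real) \<Rightarrow> bool" where
  "smooth_on n U f \<longleftrightarrow> (\<forall>k. Ck_on n U k f)"

definition gradient :: "nat \<Rightarrow> ((nat \<Rightarrow> real) \<Rightarrow> real) \<Rightarrow> (nat \<Rightarrow> real) \<Rightarrow> (nat \<Rightarrow> real)" where
  "gradient n f x = (\<lambda>i. if i < n then partial i f x else 0)"


section \<open>Differentiability of functions on barcodes\<close>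

text \<open>The coordinates \<open>(b\<^sub>1, d\<^sub>1, \<dots>, b\<^sub>m, d\<^sub>m)\<close> of the domain are \<open>x 0, x 1, \<dots>, x (2 * m - 1)\<close>.\<close>

definition Q0 :: "nat \<Rightarrow> (nat \<Rightarrow> real) \<Rightarrow> barcode" where
  "Q0 m x = barcode_of (image_mset (\<lambda>i. (x (2 * i), ereal (x (2 * i + 1)))) (mset_set {..<m}))"

definition inf_differentiable :: "(barcode \<Rightarrow> real) \<Rightarrow> barcode \<Rightarrow> bool" where
  "inf_differentiable V D \<longleftrightarrow>
     (\<forall>m. \<forall>x \<in> topspace (Euclidean_space (2 * m)). Q0 m x = D \<longrightarrow>
        (\<exists>U. openin (Euclidean_space (2 * m)) U \<and> x \<in> U \<and> smooth_on (2 * m) U (V \<circ> Q0 m)))"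

end

theory Submission
  imports Defs
begin

text \<open>
  The distance from a point \<open>(b, d)\<close> to the diagonal, in the maximum norm, is
  \<open>\<bar>d - b\<bar> / 2\<close>, and it is attained at the midpoint \<open>((b + d) / 2, (b + d) / 2)\<close>.
  In a bijection onto the empty barcode every point is sent to the diagonal, so each such bijection
  costs at least the largest of these distances. Conversely, since diagonal points have infinite
  multiplicity, all points can be sent to their midpoints while the diagonal points keep their
  position (lemma \<open>midpoint_matching_exists\<close>). Hence the bottleneck distance to the empty
  barcode is the supremum of the distances to the diagonal (\<open>bottleneck_empty_barcode\<close>).

  If the maximum is attained by a single copy, then that copy is off the diagonal, and
  every preimage \<open>(b\<^sub>1, d\<^sub>1, \<dots>, b\<^sub>m, d\<^sub>m)\<close> of the barcode has exactly one index \<open>i\<close>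
  maximising \<open>\<bar>d\<^sub>i - b\<^sub>i\<bar>\<close>, and \<open>d\<^sub>i \<noteq> b\<^sub>i\<close> (\<open>Bar_Delta_Q0_unique_index\<close>). Strict
  inequalities between continuous functions persist nearby, so on a whole neighbourhood the distance is
  \<open>s * (d\<^sub>i - b\<^sub>i) / 2\<close> with the constant sign \<open>s\<close> of \<open>d\<^sub>i - b\<^sub>i\<close>
  (\<open>dist_empty_Q0_locally_affine\<close>). A linear function is smooth, and its gradient has the
  entries \<open>s / 2\<close> and \<open>- s / 2\<close> and otherwise zeros.
\<close>

section \<open>The distance to the empty barcode\<close>

definition mid :: "real \<times> ereal \<Rightarrow> real \<times> ereal" where
  "mid x = ((fst x + real_of_ereal (snd x)) / 2, ereal ((fst x + real_of_ereal (snd x)) / 2))"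

lemma mid_in_diagonal: "mid x \<in> diagonal"
  unfolding mid_def diagonal_def by blast

lemma mid_diagonal: "x \<in> diagonal \<Longrightarrow> mid x = x"
  by (auto simp: mid_def diagonal_def)

lemma linf_dist_ereal:
  "linf_dist (b, ereal d) (c, ereal c') = ereal (max \<bar>b - c\<bar> \<bar>d - c'\<bar>)"
  by (simp add: linf_dist_def coord_dist_def flip: ereal_max)

lemma diag_dist_ereal: "diag_dist (b, ereal d) = ereal (\<bar>d - b\<bar> / 2)"
  by (simp add: diag_dist_def)

lemma linf_dist_mid:
  assumes "\<bar>snd x\<bar> \<noteq> \<infinity>"
  shows "linf_dist x (mid x) = diag_dist x"
proof -
  obtain b d where x: "x = (b, ereal d)"
    using assms by (cases x; cases "snd x") auto
  have "\<bar>b - (b + d) / 2\<bar> = \<bar>d - b\<bar> / 2" "\<bar>d - (b + d) / 2\<bar> = \<bar>d - b\<bar> / 2"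
    by argo+
  then show ?thesis
    by (simp add: x mid_def linf_dist_ereal diag_dist_ereal)
qed

lemma diag_dist_le_linf_dist:
  assumes "\<bar>snd x\<bar> \<noteq> \<infinity>" and "y \<in> diagonal"
  shows "diag_dist x \<le> linf_dist x y"
proof -
  obtain b d where x: "x = (b, ereal d)"
    using assms by (cases x; cases "snd x") auto
  obtain c where y: "y = (c, ereal c)"
    using assms by (auto simp: diagonal_def)
  have "\<bar>d - b\<bar> / 2 \<le> \<bar>b - c\<bar> \<or> \<bar>d - b\<bar> / 2 \<le> \<bar>d - c\<bar>"
    using abs_triangle_ineq4[of "d - c" "b - c"] by (simp, argo)
  then show ?thesis
    by (simp add: x y linf_dist_ereal diag_dist_ereal le_max_iff_disj)
qed

lemma copies_empty_barcode: "copies empty_barcode = diagonal \<times> UNIV"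
  by (auto simp: copies_def empty_barcode_def split: if_splits)

lemma copies_barcode_of:
  "copies (barcode_of M) = diagonal \<times> UNIV \<union> {(x, k). x \<notin> diagonal \<and> k < count M x}"
  by (auto simp: copies_def barcode_of_def empty_barcode_def)

lemma finite_labelled_mset: "finite {(x, k). k < count M x}"
proof (rule finite_subset)
  show "{(x, k). k < count M x} \<subseteq> (SIGMA x:set_mset M. {..<count M x})"
    by (auto simp: count_greater_zero_iff[symmetric] simp del: count_greater_zero_iff)
qed auto

text \<open>
  This is where the infinite multiplicity of the diagonal enters. The copies whose midpoint is a
  given diagonal point \<open>c\<close> are the countably many copies of \<open>c\<close> itself and finitely many
  others, so they can be put in bijection with the copies of \<open>c\<close> alone. These bijections, one
  for each \<open>c\<close>, have disjoint domains and disjoint ranges and fit together.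
\<close>

lemma midpoint_matching_exists:
  "\<exists>\<gamma>. bij_betw \<gamma> (copies (barcode_of M)) (copies empty_barcode) \<and>
       (\<forall>p \<in> copies (barcode_of M). fst (\<gamma> p) = mid (fst p))"
proof -
  let ?C = "copies (barcode_of M)"
  define A where "A c = {p \<in> ?C. mid (fst p) = c}" for c
  have "\<exists>g. bij_betw g (A c) ({c} \<times> (UNIV :: nat set))" if c: "c \<in> diagonal" for c
  proof -
    have sub: "A c \<subseteq> {c} \<times> UNIV \<union> {(x, k). k < count M x}"
      by (auto simp: A_def copies_barcode_of mid_diagonal)
    have "countable (A c)"
      by (rule countable_subset[OF sub])
        (auto intro: countable_finite finite_labelled_mset)
    moreover have "{c} \<times> UNIV \<subseteq> A c"
      using c by (auto simp: A_def copies_barcode_of mid_diagonal)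
    then have "infinite (A c)"
      by (rule infinite_super) (simp add: finite_cartesian_product_iff)
    ultimately have "bij_betw (to_nat_on (A c)) (A c) UNIV"
      by (rule to_nat_on_infinite)
    moreover have "bij_betw (Pair c) UNIV ({c} \<times> (UNIV :: nat set))"
      by (auto simp: bij_betw_def inj_on_def)
    ultimately show ?thesis
      by (blast intro: bij_betw_trans)
  qed
  then obtain g where g: "\<And>c. c \<in> diagonal \<Longrightarrow> bij_betw (g c) (A c) ({c} \<times> (UNIV :: nat set))"
    by metis
  \<comment> \<open>Each copy is moved by the bijection of the fibre that contains it.\<close>
  define \<gamma> where "\<gamma> p = g (mid (fst p)) p" for p
  have bij: "bij_betw \<gamma> (A c) ({c} \<times> UNIV)" if "c \<in> diagonal" for c
    using g[OF that] by (rule iffD1[OF bij_betw_cong, rotated]) (auto simp: A_def \<gamma>_def)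
  have "bij_betw \<gamma> (\<Union>c\<in>diagonal. A c) (\<Union>c\<in>diagonal. {c} \<times> UNIV)"
    using bij by (intro bij_betw_UNION_disjoint) (auto simp: disjoint_family_on_def)
  moreover have "(\<Union>c\<in>diagonal. A c) = ?C"
    using mid_in_diagonal by (auto simp: A_def)
  moreover have "(\<Union>c\<in>diagonal. {c} \<times> UNIV) = copies empty_barcode"
    by (auto simp: copies_empty_barcode)
  moreover have "fst (\<gamma> p) = mid (fst p)" if "p \<in> ?C" for p
  proof -
    have "p \<in> A (mid (fst p))"
      using that by (simp add: A_def)
    then have "\<gamma> p \<in> {mid (fst p)} \<times> UNIV"
      using bij_betwE[OF bij[OF mid_in_diagonal]] by blast
    then show ?thesis
      by auto
  qed
  ultimately show ?thesis
    by auto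
qed

lemma bottleneck_empty_barcode:
  assumes fin: "\<And>x. x \<in># M \<Longrightarrow> \<bar>snd x\<bar> \<noteq> \<infinity>"
  shows "bottleneck (barcode_of M) empty_barcode = (SUP p \<in> copies (barcode_of M). diag_dist (fst p))"
proof -
  let ?C = "copies (barcode_of M)"
  have fin': "\<bar>snd (fst p)\<bar> \<noteq> \<infinity>" if "p \<in> ?C" for p
    using that fin[of "fst p"]
    by (auto simp: copies_barcode_of diagonal_def count_greater_zero_iff[symmetric]
        simp del: count_greater_zero_iff)
  obtain \<gamma> where \<gamma>: "bij_betw \<gamma> ?C (copies empty_barcode)"
    and mid: "\<And>p. p \<in> ?C \<Longrightarrow> fst (\<gamma> p) = mid (fst p)"
    using midpoint_matching_exists[of M] by blast
  show ?thesis
    unfolding bottleneck_def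
  proof (rule antisym)
    have "(SUP p \<in> ?C. linf_dist (fst p) (fst (\<gamma> p))) = (SUP p \<in> ?C. diag_dist (fst p))"
      by (intro SUP_cong refl) (simp add: mid linf_dist_mid fin')
    then show "(INF \<gamma> \<in> {\<gamma>. bij_betw \<gamma> ?C (copies empty_barcode)}.
        SUP p \<in> ?C. linf_dist (fst p) (fst (\<gamma> p))) \<le> (SUP p \<in> ?C. diag_dist (fst p))"
      using \<gamma> by (intro INF_lower2[of \<gamma>]) auto
  next
    show "(SUP p \<in> ?C. diag_dist (fst p)) \<le> (INF \<gamma> \<in> {\<gamma>. bij_betw \<gamma> ?C (copies empty_barcode)}.
        SUP p \<in> ?C. linf_dist (fst p) (fst (\<gamma> p)))"
    proof (rule INF_greatest, rule SUP_subset_mono[OF order_refl])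
      fix \<delta> p
      assume \<delta>: "\<delta> \<in> {\<gamma>. bij_betw \<gamma> ?C (copies empty_barcode)}" and p: "p \<in> ?C"
      have "\<delta> p \<in> copies empty_barcode"
        using bij_betw_apply[of \<delta>] \<delta> p by simp
      then have "fst (\<delta> p) \<in> diagonal"
        by (simp add: copies_empty_barcode mem_Times_iff)
      with fin'[OF p] show "diag_dist (fst p) \<le> linf_dist (fst p) (fst (\<delta> p))"
        by (rule diag_dist_le_linf_dist)
    qed
  qed
qed

section \<open>Barcodes with a unique most persistent point\<close>

text \<open>
  All copies of the diagonal contribute \<open>0\<close> to the supremum, and every other copy sits at one
  of the \<open>m\<close> listed points, so the supremum is a maximum over indices.
\<close>

lemma dist_empty_Q0:
  assumes i: "i < m"
    and max: "\<And>j. j < m \<Longrightarrow> \<bar>y (2 * j + 1) - y (2 * j)\<bar> \<le> \<bar>y (2 * i + 1) - y (2 * i)\<bar>"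
  shows "dist_empty (Q0 m y) = \<bar>y (2 * i + 1) - y (2 * i)\<bar> / 2"
proof -
  define pt where "pt = (\<lambda>j. (y (2 * j), ereal (y (2 * j + 1))))"
  define M where "M = image_mset pt (mset_set {..<m})"
  let ?r = "\<bar>y (2 * i + 1) - y (2 * i)\<bar> / 2"
  have Q0: "Q0 m y = barcode_of M"
    by (simp add: Q0_def M_def pt_def)
  have dd: "diag_dist (pt j) = ereal (\<bar>y (2 * j + 1) - y (2 * j)\<bar> / 2)" for j
    by (simp add: pt_def diag_dist_ereal)
  have le: "diag_dist (fst p) \<le> ereal ?r" if p: "p \<in> copies (barcode_of M)" for p
  proof (cases "fst p \<in> diagonal")
    case True
    then show ?thesis
      by (auto simp: diagonal_def diag_dist_def)
  next
    case False
    then have "fst p \<in># M"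
      using p by (auto simp: copies_barcode_of count_greater_zero_iff[symmetric]
          simp del: count_greater_zero_iff)
    then obtain j where "j < m" "fst p = pt j"
      by (auto simp: M_def)
    then show ?thesis
      using max[of j] by (simp add: dd)
  qed
  have "pt i \<in># M"
    using i by (auto simp: M_def)
  then have in_copies: "(pt i, 0) \<in> copies (barcode_of M)"
    by (cases "pt i \<in> diagonal") (auto simp: copies_barcode_of)
  have "bottleneck (barcode_of M) empty_barcode = (SUP p \<in> copies (barcode_of M). diag_dist (fst p))"
    by (rule bottleneck_empty_barcode) (auto simp: M_def pt_def)
  also have "\<dots> = ereal ?r"
  proof (rule antisym)
    show "(SUP p \<in> copies (barcode_of M). diag_dist (fst p)) \<le> ereal ?r"
      using le by (rule SUP_least)
    show "ereal ?r \<le> (SUP p \<in> copies (barcode_of M). diag_dist (fst p))"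
      by (rule SUP_upper2[OF in_copies]) (simp add: dd)
  qed
  finally show ?thesis
    by (simp add: dist_empty_def Q0)
qed

text \<open>
  The unique maximiser is off the diagonal, since a diagonal point comes with infinitely many
  equally distant copies. A second index with the same distance would give a second maximising
  copy: a copy of another point, or a second copy of the same point.
\<close>

lemma Bar_Delta_Q0_unique_index:
  assumes "Q0 m x \<in> Bar_Delta"
  shows "\<exists>i<m. x (2 * i + 1) \<noteq> x (2 * i) \<and>
    (\<forall>j<m. j \<noteq> i \<longrightarrow> \<bar>x (2 * j + 1) - x (2 * j)\<bar> < \<bar>x (2 * i + 1) - x (2 * i)\<bar>)"
proof -
  define pt where "pt = (\<lambda>j. (x (2 * j), ereal (x (2 * j + 1))))"
  define M where "M = image_mset pt (mset_set {..<m})"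
  let ?C = "copies (barcode_of M)"
  have "Q0 m x = barcode_of M"
    by (simp add: Q0_def M_def pt_def)
  then have "card {p. is_arg_max (\<lambda>p. diag_dist (fst p)) (\<lambda>p. p \<in> ?C) p} = 1"
    using assms by (simp add: Bar_Delta_def)
  then obtain p where p: "{p. is_arg_max (\<lambda>p. diag_dist (fst p)) (\<lambda>p. p \<in> ?C) p} = {p}"
    by (auto simp: card_1_singleton_iff)
  obtain z k where zk: "p = (z, k)"
    by (cases p)
  have zC: "(z, k) \<in> ?C" and zmax: "\<And>q. q \<in> ?C \<Longrightarrow> diag_dist (fst q) \<le> diag_dist z"
  proof -
    have "is_arg_max (\<lambda>p. diag_dist (fst p)) (\<lambda>p. p \<in> ?C) (z, k)"
      using p zk by blast
    then show "(z, k) \<in> ?C" and "\<And>q. q \<in> ?C \<Longrightarrow> diag_dist (fst q) \<le> diag_dist z"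
      unfolding is_arg_max_def by (metis fst_conv not_less)+
  qed
  have uniq: "q = (z, k)" if "q \<in> ?C" "diag_dist (fst q) = diag_dist z" for q
  proof -
    have "is_arg_max (\<lambda>p. diag_dist (fst p)) (\<lambda>p. p \<in> ?C) q"
      using that zmax unfolding is_arg_max_def by (metis not_less)
    then show ?thesis
      using p zk by blast
  qed
  have nd: "z \<notin> diagonal"
  proof
    assume "z \<in> diagonal"
    then have "(z, Suc k) \<in> ?C"
      by (simp add: copies_barcode_of)
    from uniq[OF this] show False
      by simp
  qed
  then have "k < count M z"
    using zC by (simp add: copies_barcode_of)
  then have "z \<in># M"
    by (metis count_greater_zero_iff gr_implies_not0 gr_zeroI)
  then obtain i where i: "i < m" "z = pt i"
    by (auto simp: M_def)
  have dd: "diag_dist (pt j) = ereal (\<bar>x (2 * j + 1) - x (2 * j)\<bar> / 2)" for j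
    by (simp add: pt_def diag_dist_ereal)
  have "x (2 * i + 1) \<noteq> x (2 * i)"
    using nd by (auto simp: i pt_def diagonal_def)
  moreover have "\<bar>x (2 * j + 1) - x (2 * j)\<bar> < \<bar>x (2 * i + 1) - x (2 * i)\<bar>"
    if j: "j < m" "j \<noteq> i" for j
  proof -
    have "pt j \<in># M"
      using j by (auto simp: M_def)
    then have jC: "(pt j, 0) \<in> ?C"
      by (cases "pt j \<in> diagonal") (auto simp: copies_barcode_of)
    have "diag_dist (pt j) \<noteq> diag_dist z"
    proof
      assume eq: "diag_dist (pt j) = diag_dist z"
      have "pt j = z" "k = 0"
        using uniq[OF jC] eq by auto
      \<comment> \<open>Two indices with the same point give it multiplicity at least two.\<close>
      have "{#pt i, pt j#} \<subseteq># M"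
      proof -
        have "mset_set {i, j} \<subseteq># mset_set {..<m}"
          using i j by (intro subset_imp_msubset_mset_set) auto
        then have "image_mset pt (mset_set {i, j}) \<subseteq># M"
          unfolding M_def by (rule image_mset_subseteq_mono)
        then show ?thesis
          using j by simp
      qed
      then have "count {#pt i, pt j#} z \<le> count M z"
        by (rule mset_subset_eq_count)
      then have "(z, 1) \<in> ?C"
        using nd \<open>pt j = z\<close> i by (simp add: copies_barcode_of)
      from uniq[OF this] show False
        using \<open>k = 0\<close> by simp
    qed
    then show ?thesis
      using zmax[OF jC] by (simp add: i dd)
  qed
  ultimately show ?thesis
    using i by blast
qed

section \<open>Functions that are locally affine\<close>

lemma eventually_update_in_open:
  assumes U: "openin (Euclidean_space n) U" and x: "x \<in> U" and i: "i < n"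
  shows "\<forall>\<^sub>F t in nhds (x i). x(i := t) \<in> U"
proof -
  have x0: "\<forall>j\<ge>n. x j = 0"
    using openin_subset[OF U] x by (auto simp: topspace_Euclidean_space)
  have "continuous_map euclideanreal (Euclidean_space n) (\<lambda>t. x(i := t))"
    using x0 i unfolding Euclidean_space_def
    by (auto simp: continuous_map_in_subtopology continuous_map_componentwise_UNIV)
  then have "open {t. x(i := t) \<in> U}"
    using openin_continuous_map_preimage[OF _ U] by fastforce
  then show ?thesis
    using x by (auto simp: eventually_nhds)
qed

text \<open>
  Partial derivatives at a point of an open set depend only on the values on that set, because
  moving one coordinate slightly stays inside the set. By induction on the order the same holds for
  being of class \<open>C\<^sup>k\<close>, which permits replacing a function by its local formula.
\<close>

lemma partial_cong:
  assumes U: "openin (Euclidean_space n) U" and fg: "\<forall>y\<in>U. f y = g y"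
    and x: "x \<in> U" and i: "i < n"
  shows "partial i f x = partial i g x"
    and "(\<lambda>t. f (x(i := t))) field_differentiable at (x i) \<longleftrightarrow>
         (\<lambda>t. g (x(i := t))) field_differentiable at (x i)"
proof -
  have ev: "\<forall>\<^sub>F t in nhds (x i). f (x(i := t)) = g (x(i := t))"
    using eventually_update_in_open[OF U x i] by eventually_elim (use fg in blast)
  show "partial i f x = partial i g x"
    unfolding partial_def by (rule deriv_cong_ev[OF ev refl])
  show "(\<lambda>t. f (x(i := t))) field_differentiable at (x i) \<longleftrightarrow>
      (\<lambda>t. g (x(i := t))) field_differentiable at (x i)"
    unfolding field_differentiable_def using DERIV_cong_ev[OF refl ev refl] by blast
qed

lemma Ck_on_cong:
  assumes U: "openin (Euclidean_space n) U"
  shows "\<forall>y\<in>U. f y = g y \<Longrightarrow> Ck_on n U k f \<longleftrightarrow> Ck_on n U k g"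
proof (induction k arbitrary: f g)
  case 0
  then show ?case
    by (auto intro: continuous_map_eq)
next
  case (Suc k)
  have "Ck_on n U k (partial i f) \<longleftrightarrow> Ck_on n U k (partial i g)" if "i < n" for i
    using partial_cong(1)[OF U Suc.prems _ that] by (intro Suc.IH ballI)
  moreover have "continuous_map (subtopology (Euclidean_space n) U) euclideanreal f \<longleftrightarrow>
      continuous_map (subtopology (Euclidean_space n) U) euclideanreal g"
    using Suc.prems by (auto intro: continuous_map_eq)
  ultimately show ?case
    using partial_cong(2)[OF U Suc.prems] unfolding Ck_on.simps by blast
qed

lemma continuous_map_Euclidean_space_coord:
  "continuous_map (Euclidean_space n) euclideanreal (\<lambda>y. y p)"
  unfolding Euclidean_space_def
  by (intro continuous_map_from_subtopology continuous_map_product_projection) auto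

lemma Ck_on_const: "Ck_on n U k (\<lambda>_. c)"
proof (induction k arbitrary: c)
  case (Suc k)
  have "partial i (\<lambda>_. c) = (\<lambda>_. 0)" for i
    by (simp add: partial_def fun_eq_iff)
  then show ?case
    using Suc.IH by simp
qed simp

lemma coord_combination_derivative:
  "((\<lambda>t. a * (x(i := t)) p + b * (x(i := t)) q) has_field_derivative
     (if i = p then a else 0) + (if i = q then b else 0)) (at t0)" for a b :: real
  by (auto intro!: derivative_eq_intros)

lemma partial_coord_combination:
  "partial i (\<lambda>y. a * y p + b * y q) x = (if i = p then a else 0) + (if i = q then b else 0)"
  unfolding partial_def by (rule DERIV_imp_deriv[OF coord_combination_derivative])

lemma smooth_on_coord_combination: "smooth_on n U (\<lambda>y. a * y p + b * y q)"
  unfolding smooth_on_def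
proof
  fix k
  have cont: "continuous_map (subtopology (Euclidean_space n) U) euclideanreal
      (\<lambda>y. a * y p + b * y q)"
    by (intro continuous_intros continuous_map_from_subtopology
        continuous_map_Euclidean_space_coord)
  have "(\<lambda>t. a * (x(i := t)) p + b * (x(i := t)) q) field_differentiable at (x i)" for i x
    unfolding field_differentiable_def by (rule exI, rule coord_combination_derivative)
  moreover have "Ck_on n U k' (partial i (\<lambda>y. a * y p + b * y q))" for i k'
    using Ck_on_const unfolding partial_coord_combination[abs_def] .
  ultimately show "Ck_on n U k (\<lambda>y. a * y p + b * y q)"
    using cont by (cases k) auto
qed

section \<open>The distance near a barcode with a unique most persistent point\<close>

text \<open>
  The neighbourhood is cut out by \<open>m\<close> strict inequalities: one keeps the sign of
  \<open>d\<^sub>i - b\<^sub>i\<close>, the others keep \<open>i\<close> the unique maximising index.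
\<close>

lemma dist_empty_Q0_locally_affine:
  assumes x: "x \<in> topspace (Euclidean_space (2 * m))" and Delta: "Q0 m x \<in> Bar_Delta"
  shows "\<exists>U i s. openin (Euclidean_space (2 * m)) U \<and> x \<in> U \<and> i < m \<and> (s = 1 \<or> s = -1) \<and>
    (\<forall>y \<in> U. dist_empty (Q0 m y) = s / 2 * y (2 * i + 1) + - s / 2 * y (2 * i))"
proof -
  let ?E = "Euclidean_space (2 * m)"
  obtain i where i: "i < m" and ne: "x (2 * i + 1) \<noteq> x (2 * i)"
    and max: "\<And>j. j < m \<Longrightarrow> j \<noteq> i \<Longrightarrow>
      \<bar>x (2 * j + 1) - x (2 * j)\<bar> < \<bar>x (2 * i + 1) - x (2 * i)\<bar>"
    using Bar_Delta_Q0_unique_index[OF Delta] by blast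
  define s where "s = sgn (x (2 * i + 1) - x (2 * i))"
  have s: "s = 1 \<or> s = -1"
    using ne by (auto simp: s_def sgn_if)
  define h where "h y = s * (y (2 * i + 1) - y (2 * i))" for y :: "nat \<Rightarrow> real"
  have hx: "h x = \<bar>x (2 * i + 1) - x (2 * i)\<bar>"
    by (simp add: h_def s_def sgn_mult_self_eq abs_sgn mult.commute)
  define gap where "gap j y = (if j = i then h y else h y - \<bar>y (2 * j + 1) - y (2 * j)\<bar>)" for j y
  define U where "U = (\<Inter>j\<in>{..<m}. {y \<in> topspace ?E. gap j y \<in> {0<..}})"
  have "continuous_map ?E euclideanreal (gap j)" for j
    unfolding gap_def h_def
    by (cases "j = i") (auto intro!: continuous_intros continuous_map_Euclidean_space_coord)
  then have "openin ?E {y \<in> topspace ?E. gap j y \<in> {0<..}}" for j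
    by (rule openin_continuous_map_preimage) simp
  then have "openin ?E U"
    unfolding U_def using i by (intro openin_INT2) auto
  moreover have "x \<in> U"
    using x ne max by (auto simp: U_def gap_def hx)
  moreover have "dist_empty (Q0 m y) = s / 2 * y (2 * i + 1) + - s / 2 * y (2 * i)"
    if y: "y \<in> U" for y
  proof -
    have gap: "gap j y > 0" if "j < m" for j
      using y that by (auto simp: U_def)
    have h: "h y = \<bar>y (2 * i + 1) - y (2 * i)\<bar>"
      using gap[OF i] s by (auto simp: gap_def h_def)
    have "\<bar>y (2 * j + 1) - y (2 * j)\<bar> \<le> \<bar>y (2 * i + 1) - y (2 * i)\<bar>" if "j < m" for j
      using gap[OF that] h by (cases "j = i") (auto simp: gap_def)
    from dist_empty_Q0[OF i this] have "dist_empty (Q0 m y) = h y / 2"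
      by (simp add: h)
    then show ?thesis
      by (simp add: h_def field_simps)
  qed
  ultimately show ?thesis
    using i s by blast
qed

theorem proposition7p9:
  fixes D :: barcode
  assumes "D \<in> Bar_Delta"
  shows "inf_differentiable dist_empty D \<and>
    (\<forall>m. \<forall>x \<in> topspace (Euclidean_space (2 * m)). Q0 m x = D \<longrightarrow>
       (\<exists>i j. i \<noteq> j \<and>
          {k \<in> {..<2 * m}. gradient (2 * m) (dist_empty \<circ> Q0 m) x k \<noteq> 0} = {i, j} \<and>
          gradient (2 * m) (dist_empty \<circ> Q0 m) x i = 1 / 2 \<and>
          gradient (2 * m) (dist_empty \<circ> Q0 m) x j = - 1 / 2))"
proof (intro conjI allI ballI impI)
  show "inf_differentiable dist_empty D"
    unfolding inf_differentiable_def
  proof (intro allI ballI impI)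
    fix m x
    assume x: "x \<in> topspace (Euclidean_space (2 * m))" and Q: "Q0 m x = D"
    obtain U i s where U: "openin (Euclidean_space (2 * m)) U" "x \<in> U"
      and eq: "\<forall>y\<in>U.
        (dist_empty \<circ> Q0 m) y = s / 2 * y (2 * i + 1) + - s / 2 * y (2 * i)"
      using dist_empty_Q0_locally_affine[OF x] assms Q by auto
    have "smooth_on (2 * m) U (dist_empty \<circ> Q0 m)"
      using smooth_on_coord_combination Ck_on_cong[OF U(1) eq]
      unfolding smooth_on_def by blast
    then show "\<exists>U. openin (Euclidean_space (2 * m)) U \<and> x \<in> U \<and>
        smooth_on (2 * m) U (dist_empty \<circ> Q0 m)"
      using U by blast
  qed
next
  fix m x
  assume x: "x \<in> topspace (Euclidean_space (2 * m))" and Q: "Q0 m x = D"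
  let ?G = "gradient (2 * m) (dist_empty \<circ> Q0 m) x"
  obtain U i s where U: "openin (Euclidean_space (2 * m)) U" "x \<in> U"
    and i: "i < m" and s: "s = 1 \<or> s = -1"
    and eq: "\<forall>y\<in>U.
      (dist_empty \<circ> Q0 m) y = s / 2 * y (2 * i + 1) + - s / 2 * y (2 * i)"
    using dist_empty_Q0_locally_affine[OF x] assms Q by auto
  have G: "?G k = (if k = 2 * i + 1 then s / 2 else 0) + (if k = 2 * i then - s / 2 else 0)"
    if "k < 2 * m" for k
    using that unfolding gradient_def partial_cong(1)[OF U(1) eq U(2) that]
      partial_coord_combination by simp
  have supp: "{k \<in> {..<2 * m}. ?G k \<noteq> 0} = {2 * i + 1, 2 * i}"
    using i s by (auto simp: G split: if_splits)
  have vals: "?G (2 * i + 1) = s / 2" "?G (2 * i) = - s / 2"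
    using i by (simp_all add: G)
  \<comment> \<open>The sign decides whether the death or the birth coordinate carries the value
    \<open>1 / 2\<close>.\<close>
  from s show "\<exists>i j. i \<noteq> j \<and> {k \<in> {..<2 * m}. ?G k \<noteq> 0} = {i, j} \<and> ?G i = 1 / 2 \<and> ?G j = - 1 / 2"
  proof
    assume "s = 1"
    then show ?thesis
      using supp vals by (intro exI[of _ "2 * i + 1"] exI[of _ "2 * i"]) simp
  next
    assume "s = -1"
    then show ?thesis
      using supp vals by (intro exI[of _ "2 * i"] exI[of _ "2 * i + 1"]) (simp add: insert_commute)
  qed
qed

end
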